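(* Let $X$ be a random motion governed by a point process $N$ and moving with velocities $v_0,\dots,v_M\in\mathbb{R}^D$, with $D<M\in\mathbb{N}$, such that $\dim\big(\mathrm{Conv}(v_0,\dots,v_M)\big)=D$. Then there exists a minimal random motion $\tilde X$ in $\mathbb{R}^M$ such that $X$ is the marginal vector process of $\tilde X$ represented by its first $D$ components, i.e. $X(t)=(I_D\ \ 0)\,\tilde X(t)$ for all $t\ge 0$.
   Context: Random motion. Let $(W_n)_{n\ge 0}$ be random variables with $W_n\ge 0$ a.s. and $W_0=0$ a.s., let $T_n=\sum_{i=0}^n W_i$ and $N(t)=\max\{n\ge 0:\ T_n\le t\}$, with $N(t)<\infty$ a.s. for all $t\ge 0$. Let $V=\{V(t)\}_{t\ge 0}$ take values in a finite set $\{v_0,\dots,v_M\}\subset\mathbb{R}^D$ and change value only when $N$ records an event, so $V(t)=V(T_{N(t)})$. The random motion with velocities $v_0,\dots,v_M$ governed by $N$ is $X(t)=\int_0^tV(s)\,ds$. A random motion in $\mathbb{R}^m$ is called minimal if it moves with $m+1$ affinely independent velocities in $\mathbb{R}^m$. $(I_D\ \ 0)$ is the $D\times M$ matrix selecting the first $D$ coordinates. *)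

theory Defs
  imports "HOL-Probability.Probability"
begin

definition event_time :: "(nat \<Rightarrow> 'w \<Rightarrow> real) \<Rightarrow> nat \<Rightarrow> 'w \<Rightarrow> real"
  where "event_time W n \<omega> = (\<Sum>i\<le>n. W i \<omega>)"

(* Max is meaningful only for a finite nonempty set; for a point process (below)
   this is the case almost surely, for each t \<ge> 0. *)
definition event_count :: "(nat \<Rightarrow> 'w \<Rightarrow> real) \<Rightarrow> real \<Rightarrow> 'w \<Rightarrow> nat"
  where "event_count W t \<omega> = Max {n. event_time W n \<omega> \<le> t}"

(* The point process N is represented by its waiting times W; N(t) is event_count W t,
   and finiteness of the set below is the condition N(t) < \<infinity>. *)
definition point_process :: "'w measure \<Rightarrow> (nat \<Rightarrow> 'w \<Rightarrow> real) \<Rightarrow> bool"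
  where "point_process P W \<longleftrightarrow>
    (\<forall>n. W n \<in> borel_measurable P) \<and>
    (\<forall>n. AE \<omega> in P. W n \<omega> \<ge> 0) \<and>
    (AE \<omega> in P. W 0 \<omega> = 0) \<and>
    (\<forall>t\<ge>0. AE \<omega> in P. finite {n. event_time W n \<omega> \<le> t})"

(* The relation V(t) = V(T_{N(t)}) is required almost surely, simultaneously for all t \<ge> 0,
   because N(t) is undefined on a null set. Values of V and X at negative times are
   unconstrained. *)
definition random_motion ::
    "'w measure \<Rightarrow> (nat \<Rightarrow> 'w \<Rightarrow> real) \<Rightarrow> nat \<Rightarrow> (nat \<Rightarrow> real ^ 'n) \<Rightarrow>
     (real \<Rightarrow> 'w \<Rightarrow> real ^ 'n) \<Rightarrow> bool"
  where "random_motion P W M v X \<longleftrightarrow>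
    point_process P W \<and>
    (\<exists>V :: real \<Rightarrow> 'w \<Rightarrow> real ^ 'n.
      (\<forall>t\<ge>0. V t \<in> borel_measurable P) \<and>
      (\<forall>t\<ge>0. \<forall>\<omega>\<in>space P. V t \<omega> \<in> v ` {0..M}) \<and>
      (AE \<omega> in P. \<forall>t\<ge>0. V t \<omega> = V (event_time W (event_count W t \<omega>) \<omega>) \<omega>) \<and>
      (\<forall>t\<ge>0. \<forall>\<omega>\<in>space P. X t \<omega> = integral {0..t} (\<lambda>s. V s \<omega>)))"

(* Affine independence is that of the family v_0, ..., v_m, hence the injectivity. *)
definition minimal_random_motion ::
    "'w measure \<Rightarrow> (nat \<Rightarrow> 'w \<Rightarrow> real) \<Rightarrow> (nat \<Rightarrow> real ^ 'm) \<Rightarrow>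
     (real \<Rightarrow> 'w \<Rightarrow> real ^ 'm) \<Rightarrow> bool"
  where "minimal_random_motion P W v X \<longleftrightarrow>
    random_motion P W CARD('m) v X \<and>
    inj_on v {0..CARD('m)} \<and> \<not> affine_dependent (v ` {0..CARD('m)})"

(* The block matrix (I_D 0), with D = CARD('d) and M = CARD('m). The coordinates are
   enumerated in increasing order of the index type, so card {..<i} is the
   (zero-based) position of i. *)
definition first_coords :: "real ^ 'm::{finite,linorder} ^ 'd::{finite,linorder}"
  where "first_coords = (\<chi> i j. if card {..<i} = card {..<j} then 1 else 0)"

end

theory Submission
  imports Defs
begin

text \<open>
  The idea is to lift the velocities and to leave the randomness alone. The hull of
  \<open>v\<^sub>0, \<dots>, v\<^sub>M\<close> has full dimension \<open>D\<close>, so \<open>D + 1\<close> of the velocities are affinely independent.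
  These are padded with zeros to vectors of \<open>\<real>\<^sup>M\<close>. The remaining \<open>M - D\<close> velocities are as many
  as the new coordinates, and each of them is moved by one unit along a new coordinate of its own.
  In a vanishing affine combination of the lifted velocities the new coordinates annihilate the
  weights of the latter group, and affine independence then annihilates the weights of the
  former (\<open>affinely_independent_lift\<close>).

  Distinct indices may carry the same velocity \<open>v\<^sub>i\<close>, so that \<open>V\<close> does not determine an index.
  It suffices to choose one index for each value in the finite set \<open>{v\<^sub>0, \<dots>, v\<^sub>M}\<close>, which
  gives a map \<open>g\<close> into the lifted velocities that is a section of the projection. Then \<open>g (V t)\<close>
  moves with the lifted velocities, changes value only when \<open>V\<close> does, and projects to \<open>V t\<close>.

  The displacement is an integral for every outcome, including those in the null set where \<open>V\<close>
  need not be piecewise constant. The projection commutes with the integral there as well, because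
  a path of \<open>V\<close> and its lift are either both integrable or both not, and in the second case both
  integrals are zero (\<open>integral_lift_finite_range\<close>).
\<close>

section \<open>Affine independence of families\<close>

text \<open>
  For families, affine independence is the triviality of all vanishing combinations of total weight
  zero. Applied to the difference of two unit weights this also excludes repeated points.
\<close>

lemma affinely_independent_family:
  fixes f :: "'i \<Rightarrow> 'a::real_vector"
  assumes "finite I"
    and triv: "\<And>c i. (\<Sum>i\<in>I. c i) = 0 \<Longrightarrow> (\<Sum>i\<in>I. c i *\<^sub>R f i) = 0 \<Longrightarrow> i \<in> I \<Longrightarrow> c i = 0"
  shows "inj_on f I" and "\<not> affine_dependent (f ` I)"
proof -
  show inj: "inj_on f I"
  proof (rule inj_onI, rule ccontr)
    fix a b assume ab: "a \<in> I" "b \<in> I" "f a = f b" "a \<noteq> b"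
    define c :: "'i \<Rightarrow> real" where "c i = (if i = a then 1 else 0) - (if i = b then 1 else 0)" for i
    have "(\<Sum>i\<in>I. c i) = 0"
      using ab assms(1) by (simp add: c_def sum_subtractf)
    moreover have "(\<Sum>i\<in>I. c i *\<^sub>R f i) = 0"
      using ab assms(1)
      by (simp add: c_def scaleR_left_diff_distrib sum_subtractf if_distrib[of "\<lambda>x. x *\<^sub>R _"]
          cong: if_cong)
    ultimately have "c a = 0" using triv ab by blast
    then show False using ab by (simp add: c_def)
  qed
  show "\<not> affine_dependent (f ` I)"
  proof
    assume "affine_dependent (f ` I)"
    then obtain U x where U: "sum U (f ` I) = 0" "x \<in> f ` I" "U x \<noteq> 0"
      "(\<Sum>x\<in>f ` I. U x *\<^sub>R x) = 0"
      using affine_dependent_explicit_finite[of "f ` I"] assms(1) by auto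
    then obtain i where i: "i \<in> I" "x = f i" by auto
    have "U (f i) = 0"
      using triv[of "U \<circ> f" i] U i by (simp add: sum.reindex[OF inj])
    then show False using U i by simp
  qed
qed

text \<open>
  Values at different indices may coincide, so an affine basis of the image is represented by
  a choice of indices on which the family is injective.
\<close>

lemma affine_basis_indices:
  fixes f :: "'i \<Rightarrow> 'a::euclidean_space"
  assumes "finite I"
  obtains B where "B \<subseteq> I" "inj_on f B" "\<not> affine_dependent (f ` B)"
    "int (card B) = aff_dim (f ` I) + 1"
proof -
  obtain b where b: "\<not> affine_dependent b" "b \<subseteq> f ` I" "affine hull b = affine hull (f ` I)"
    using affine_basis_exists[of "f ` I"] by metis
  obtain B where B: "B \<subseteq> I" "inj_on f B" "b = f ` B"
    using b(2) by (meson subset_image_inj)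
  have "aff_dim (f ` I) = int (card b) - 1"
    using aff_dim_unique[of b "f ` I"] b by linarith
  moreover have "card b = card B" using B card_image by blast
  ultimately show ?thesis using that B b by auto
qed

section \<open>Lifting the velocities\<close>

text \<open>
  The coordinates outside the range of \<open>e\<close> are the new ones. There are as many of them as there are
  indices outside an affine basis of the family, which is what makes the bijection below possible.
\<close>

lemma affinely_independent_lift:
  fixes v :: "'i \<Rightarrow> real ^ 'd" and e :: "'d \<Rightarrow> 'm::finite"
  assumes "finite I" and "card I = CARD('m) + 1" and e: "inj e"
    and dim: "aff_dim (v ` I) = int CARD('d)"
  obtains v' :: "'i \<Rightarrow> real ^ 'm"
  where "\<And>i k. v' i $ e k = v i $ k" and "inj_on v' I" and "\<not> affine_dependent (v' ` I)"
proof -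
  obtain B where B: "B \<subseteq> I" "inj_on v B" "\<not> affine_dependent (v ` B)"
    "int (card B) = int CARD('d) + 1"
    using affine_basis_indices[OF assms(1), of v] unfolding dim by metis
  have finB: "finite B" using B(1) assms(1) finite_subset by blast
  have "card (I - B) = CARD('m) - CARD('d)"
    using card_Diff_subset[OF finB B(1)] B(4) assms(2) by linarith
  also have "\<dots> = card (- range e)"
    using e by (simp add: Compl_eq_Diff_UNIV card_Diff_subset card_image)
  finally obtain b where b: "bij_betw b (I - B) (- range e)"
    using finite_same_card_bij[of "I - B" "- range e"] assms(1) by auto
  define v' :: "'i \<Rightarrow> real ^ 'm" where "v' i = (\<chi> j. if j \<in> range e then v i $ inv e j
      else if i \<in> I - B \<and> b i = j then 1 else 0)" for i
  have proj: "v' i $ e k = v i $ k" for i k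
    using e by (simp add: v'_def)
  have triv: "c i = 0"
    if c: "(\<Sum>i\<in>I. c i) = 0" "(\<Sum>i\<in>I. c i *\<^sub>R v' i) = 0" and i: "i \<in> I" for c i
  proof -
    have outside: "c i = 0" if i: "i \<in> I - B" for i
    proof -
      have nr: "b i \<notin> range e" using b i by (auto dest: bij_betwE)
      have "0 = (\<Sum>k\<in>I. c k *\<^sub>R v' k) $ b i" using c(2) by simp
      also have "\<dots> = (\<Sum>k\<in>I. if k = i then c i else 0)"
        unfolding sum_component
      proof (rule sum.cong)
        fix k assume "k \<in> I"
        have "k \<in> I - B \<and> b k = b i \<longleftrightarrow> k = i"
          using b i by (auto simp: bij_betw_def inj_on_def)
        then show "(c k *\<^sub>R v' k) $ b i = (if k = i then c i else 0)"
          using nr by (simp add: v'_def)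
      qed simp
      finally show ?thesis using i assms(1) by simp
    qed
    have sumB: "(\<Sum>i\<in>B. c i) = 0"
      using sum.mono_neutral_left[of I B c] assms(1) B(1) outside c(1) by simp
    have "(\<Sum>i\<in>I. c i *\<^sub>R v i) = 0"
    proof (rule vec_eq_iff[THEN iffD2], rule allI)
      fix k
      have "(\<Sum>i\<in>I. c i *\<^sub>R v' i) $ e k = 0" using c(2) by simp
      then show "(\<Sum>i\<in>I. c i *\<^sub>R v i) $ k = 0 $ k" by (simp add: sum_component proj)
    qed
    then have combB: "(\<Sum>i\<in>B. c i *\<^sub>R v i) = 0"
      using sum.mono_neutral_left[of I B "\<lambda>i. c i *\<^sub>R v i"] assms(1) B(1) outside by simp
    have "c i = 0" if "i \<in> B" for i
    proof (rule ccontr)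
      assume "c i \<noteq> 0"
      then have "\<exists>U. sum U (v ` B) = 0 \<and> (\<exists>x\<in>v ` B. U x \<noteq> 0) \<and> (\<Sum>x\<in>v ` B. U x *\<^sub>R x) = 0"
        using sumB combB B(2) that
        by (intro exI[of _ "c \<circ> inv_into B v"]) (auto simp: sum.reindex)
      then show False using B(3) affine_dependent_explicit_finite[of "v ` B"] finB by auto
    qed
    with outside i show ?thesis by blast
  qed
  have "inj_on v' I" and "\<not> affine_dependent (v' ` I)"
    by (rule affinely_independent_family[OF assms(1)], rule triv, assumption+)+
  then show ?thesis
    using that[of v'] proj by blast
qed

section \<open>The block matrix as a selection of coordinates\<close>

lemma inj_card_lessThan: "inj (\<lambda>i::'a::{finite,linorder}. card {..<i})"
proof (rule linorder_injI)
  fix x y :: 'a assume "x < y"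
  then have "{..<x} \<subset> {..<y}" by auto
  then show "card {..<x} \<noteq> card {..<y}" using psubset_card_mono[of "{..<y}" "{..<x}"] by simp
qed

lemma range_card_lessThan: "range (\<lambda>i::'a::{finite,linorder}. card {..<i}) = {..<CARD('a)}"
proof (rule card_subset_eq)
  show "range (\<lambda>i::'a. card {..<i}) \<subseteq> {..<CARD('a)}"
    by (auto intro!: psubset_card_mono)
  show "card (range (\<lambda>i::'a. card {..<i})) = card {..<CARD('a)}"
    using card_image[OF inj_card_lessThan] by simp
qed simp

lemma first_coords_selects:
  assumes "CARD('d::{finite,linorder}) \<le> CARD('m::{finite,linorder})"
  obtains e :: "'d::{finite,linorder} \<Rightarrow> 'm::{finite,linorder}" where "inj e"
    and "\<And>x k. (first_coords *v x) $ k = x $ e k"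
proof -
  have "\<exists>j::'m. card {..<j} = card {..<k}" for k :: 'd
  proof -
    have "card {..<k} \<in> range (\<lambda>j::'m. card {..<j})"
      using assms range_card_lessThan[where 'a='d] range_card_lessThan[where 'a='m]
      by (metis lessThan_subset_iff rangeI subsetD)
    then show ?thesis by auto
  qed
  then obtain e :: "'d \<Rightarrow> 'm" where e: "\<And>k. card {..<e k} = card {..<k}" by metis
  have "inj e"
    by (rule injI) (metis e inj_card_lessThan injD)
  moreover have "(first_coords *v x) $ k = x $ e k" for x k
  proof -
    have "card {..<k} = card {..<j} \<longleftrightarrow> j = e k" for j :: 'm
      by (metis e inj_card_lessThan injD)
    then show ?thesis
      by (simp add: first_coords_def matrix_vector_mult_def if_distrib[of "\<lambda>x. x * _"] cong: if_cong)
  qed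
  ultimately show ?thesis using that by blast
qed

section \<open>Lifting finitely valued paths\<close>

text \<open>
  Only the values on a finite set matter, and elsewhere the function may be taken to be zero.
  This turns an arbitrary choice of lifts into a Borel function.
\<close>

lemma borel_measurable_extension_of_finite:
  fixes h :: "'a::t1_space \<Rightarrow> 'b::euclidean_space"
  assumes "finite S"
  obtains g where "g \<in> borel_measurable borel" "finite (range g)" "\<And>x. x \<in> S \<Longrightarrow> g x = h x"
proof
  define g where "g x = (\<Sum>a\<in>S. indicat_real {a} x *\<^sub>R h a)" for x
  have g: "g x = (if x \<in> S then h x else 0)" for x
    using assms by (auto simp: g_def indicator_def of_bool_def if_distrib[of "\<lambda>x. x *\<^sub>R _"] cong: if_cong)
  show "g \<in> borel_measurable borel"
    unfolding g_def by measurable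
  have "range g \<subseteq> insert 0 (h ` S)" by (auto simp: g)
  then show "finite (range g)" using assms finite_subset by blast
  show "g x = h x" if "x \<in> S" for x using that by (simp add: g)
qed

text \<open>
  A bounded gauge integrable function is absolutely integrable, hence Lebesgue measurable. Thus its
  composition with a bounded Borel function is measurable and bounded, and so integrable.
\<close>

lemma integrable_on_compose_bounded:
  fixes f :: "'a::euclidean_space \<Rightarrow> 'b::euclidean_space"
    and g :: "'b \<Rightarrow> 'c::euclidean_space"
  assumes f: "f integrable_on cbox a b" and bf: "bounded (f ` cbox a b)"
    and g: "g \<in> borel_measurable borel" "bounded (range g)"
  shows "(g \<circ> f) integrable_on cbox a b"
proof -
  obtain C where C: "\<And>x. norm (g x) \<le> C"
    using g(2) by (auto simp: bounded_iff)
  have "f \<in> borel_measurable (lebesgue_on (cbox a b))"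
    using f by (rule integrable_imp_measurable)
  then have "(g \<circ> f) \<in> borel_measurable (lebesgue_on (cbox a b))"
    using g(1) by (rule measurable_comp)
  then show ?thesis
    by (rule measurable_bounded_by_integrable_imp_integrable[where g="\<lambda>_. C"])
       (use C in auto)
qed

lemma integral_lift_finite_range:
  fixes f :: "'a::euclidean_space \<Rightarrow> 'b::euclidean_space"
    and g :: "'b \<Rightarrow> 'c::euclidean_space"
  assumes L: "linear L" and fin: "finite (f ` cbox a b)"
    and g: "g \<in> borel_measurable borel" "finite (range g)"
    and sec: "\<And>x. x \<in> cbox a b \<Longrightarrow> L (g (f x)) = f x"
  shows "integral (cbox a b) f = L (integral (cbox a b) (\<lambda>x. g (f x)))"
proof (cases "f integrable_on cbox a b")
  case True
  then have "(g \<circ> f) integrable_on cbox a b"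
    using fin g by (intro integrable_on_compose_bounded finite_imp_bounded)
  then have "(\<lambda>x. g (f x)) integrable_on cbox a b" by (simp add: o_def)
  then have "integral (cbox a b) (L \<circ> (\<lambda>x. g (f x))) = L (integral (cbox a b) (\<lambda>x. g (f x)))"
    using L by (intro integral_linear) (simp_all add: linear_conv_bounded_linear)
  moreover have "integral (cbox a b) (L \<circ> (\<lambda>x. g (f x))) = integral (cbox a b) f"
    by (rule integral_cong) (simp add: sec)
  ultimately show ?thesis by simp
next
  case False
  have "\<not> (\<lambda>x. g (f x)) integrable_on cbox a b"
  proof
    assume "(\<lambda>x. g (f x)) integrable_on cbox a b"
    then have "(L \<circ> (\<lambda>x. g (f x))) integrable_on cbox a b"
      using L by (intro integrable_linear) (simp_all add: linear_conv_bounded_linear)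
    then have "f integrable_on cbox a b"
      using integrable_cong[of "cbox a b" "L \<circ> (\<lambda>x. g (f x))" f] sec by simp
    with False show False ..
  qed
  with False show ?thesis
    using linear_0[OF L] by (simp add: not_integrable_integral)
qed

text \<open>
  The lift exists over any linear projection that maps lifted velocities to the original ones; the
  process of event times is the same for both motions.
\<close>

lemma random_motion_lift:
  fixes v :: "nat \<Rightarrow> real ^ 'd" and v' :: "nat \<Rightarrow> real ^ 'm"
  assumes X: "random_motion P W M v X" and L: "linear L" and v': "\<And>i. L (v' i) = v i"
  obtains X' where "random_motion P W M v' X'"
    and "\<And>t \<omega>. 0 \<le> t \<Longrightarrow> \<omega> \<in> space P \<Longrightarrow> X t \<omega> = L (X' t \<omega>)"
proof -
  let ?S = "v ` {0..M}"
  from X obtain V where W: "point_process P W"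
    and Vm: "\<And>t. 0 \<le> t \<Longrightarrow> V t \<in> borel_measurable P"
    and VS: "\<And>t \<omega>. 0 \<le> t \<Longrightarrow> \<omega> \<in> space P \<Longrightarrow> V t \<omega> \<in> ?S"
    and Vev: "AE \<omega> in P. \<forall>t\<ge>0. V t \<omega> = V (event_time W (event_count W t \<omega>) \<omega>) \<omega>"
    and XV: "\<And>t \<omega>. 0 \<le> t \<Longrightarrow> \<omega> \<in> space P \<Longrightarrow> X t \<omega> = integral {0..t} (\<lambda>s. V s \<omega>)"
    unfolding random_motion_def by blast
  obtain g where g: "g \<in> borel_measurable borel" "finite (range g)"
    "\<And>x. x \<in> ?S \<Longrightarrow> g x = v' (inv_into {0..M} v x)"
    using borel_measurable_extension_of_finite[of ?S "\<lambda>x. v' (inv_into {0..M} v x)"] by auto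
  have gS: "g x \<in> v' ` {0..M}" if "x \<in> ?S" for x
    using g(3)[OF that] inv_into_into[OF that] by simp
  have sec: "L (g x) = x" if "x \<in> ?S" for x
    using g(3)[OF that] v' f_inv_into_f[OF that] by simp
  define X' where "X' t \<omega> = integral {0..t} (\<lambda>s. g (V s \<omega>))" for t \<omega>
  have "random_motion P W M v' X'"
    unfolding random_motion_def
  proof (intro conjI exI[of _ "\<lambda>t \<omega>. g (V t \<omega>)"] allI impI ballI)
    show "(\<lambda>\<omega>. g (V t \<omega>)) \<in> borel_measurable P" if "0 \<le> t" for t
      using measurable_compose[OF Vm[OF that] g(1)] .
    show "AE \<omega> in P. \<forall>t\<ge>0. g (V t \<omega>) = g (V (event_time W (event_count W t \<omega>) \<omega>) \<omega>)"
      using Vev by eventually_elim metis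
  qed (use W VS gS X'_def in auto)
  moreover have "X t \<omega> = L (X' t \<omega>)" if "0 \<le> t" "\<omega> \<in> space P" for t \<omega>
  proof -
    have S: "V s \<omega> \<in> ?S" if "s \<in> cbox 0 t" for s
      using VS that \<open>\<omega> \<in> space P\<close> by simp
    then have "finite ((\<lambda>s. V s \<omega>) ` cbox 0 t)"
      by (meson finite_imageI finite_atLeastAtMost finite_subset image_subsetI)
    then have "integral (cbox 0 t) (\<lambda>s. V s \<omega>) = L (integral (cbox 0 t) (\<lambda>s. g (V s \<omega>)))"
      using L g(1,2) S sec by (intro integral_lift_finite_range) auto
    then show ?thesis using XV[OF that] by (simp add: X'_def)
  qed
  ultimately show ?thesis using that by blast
qed

section \<open>Random motions as marginals of minimal ones\<close>

theorem proposition3p2: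
  fixes P :: "'w measure"
    and W :: "nat \<Rightarrow> 'w \<Rightarrow> real"
    and v :: "nat \<Rightarrow> real ^ ('d::{finite,linorder})"
    and X :: "real \<Rightarrow> 'w \<Rightarrow> real ^ ('d::{finite,linorder})"
  assumes "prob_space P"
    and "random_motion P W CARD('m::{finite,linorder}) v X"
    and "CARD('d::{finite,linorder}) < CARD('m::{finite,linorder})"
    and "aff_dim (convex hull (v ` {0..CARD('m::{finite,linorder})})) =
      int CARD('d::{finite,linorder})"
  shows "\<exists>(W' :: nat \<Rightarrow> 'w \<Rightarrow> real)
      (v' :: nat \<Rightarrow> real ^ ('m::{finite,linorder}))
      (X' :: real \<Rightarrow> 'w \<Rightarrow> real ^ ('m::{finite,linorder})).
    minimal_random_motion P W' v' X' \<and>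
    (\<forall>t\<ge>0. \<forall>\<omega>\<in>space P. X t \<omega> = first_coords *v X' t \<omega>)"
proof -
  obtain e :: "'d \<Rightarrow> 'm" where e: "inj e"
    and sel: "\<And>x k. (first_coords *v x) $ k = x $ e k"
    using first_coords_selects assms(3) less_imp_le by blast
  have "aff_dim (v ` {0..CARD('m)}) = int CARD('d)"
    using assms(4) by (simp add: aff_dim_convex_hull)
  then obtain v' :: "nat \<Rightarrow> real ^ 'm::{finite,linorder}"
    where v': "\<And>i k. v' i $ e k = v i $ k" "inj_on v' {0..CARD('m)}"
      "\<not> affine_dependent (v' ` {0..CARD('m)})"
    using affinely_independent_lift[of "{0..CARD('m)}" e v] e by auto
  have "first_coords *v v' i = v i" for i
    by (simp add: vec_eq_iff sel v'(1))
  with random_motion_lift[OF assms(2) matrix_vector_mul_linear]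
  obtain X' where "random_motion P W CARD('m) v' X'"
    "\<And>t \<omega>. 0 \<le> t \<Longrightarrow> \<omega> \<in> space P \<Longrightarrow> X t \<omega> = first_coords *v X' t \<omega>"
    by metis
  with v' show ?thesis
    unfolding minimal_random_motion_def by blast
qed

end
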